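(* For each fixed integer $r\ge 1$, $$p_{r,n}\to p_r\qquad\text{as } n\to\infty .$$ Moreover, $p_r>0$ for every $r\ge 1$, and $$\sum_{r=1}^\infty p_r=1 .$$
   Context: $\mathrm{Exp}(\lambda)$ denotes the exponential distribution with rate $\lambda>0$ (density $\lambda e^{-\lambda t}$, $t>0$, mean $1/\lambda$). For $n\ge 1$, let $X_1,\ldots,X_n$ be independent standard exponential ($\mathrm{Exp}(1)$) random variables with order statistics $X_{1:n}\le\cdots\le X_{n:n}$, and put $X_{0:n}:=0$. The spacings are $S_{j,n}:=X_{j:n}-X_{j-1:n}$, $j=1,\ldots,n$. Let $I_n:=\arg\max_{1\le j\le n}S_{j,n}$ be the (almost surely unique) index of the largest spacing, let $R_n:=n-I_n+1$ be this index counted from the right endpoint, and put $p_{r,n}:=\mathbb P(R_n=r)$ for $1\le r\le n$. Let $(Y_r)_{r\ge1}$ be a sequence of independent random variables with $Y_r\sim\mathrm{Exp}(r)$ for every $r\ge 1$, and define $p_r:=\mathbb P\left(Y_r=\max_{k\ge1}Y_k\right)$ for $r\ge1$, the event being that $Y_k\le Y_r$ for all $k\ge 1$. By Sukhatme's classical representation, the vector $(S_{n-r+1,n})_{1\le r\le n}$ has the same distribution as $(Y_1,\ldots,Y_n)$, so that also $p_{r,n}=\mathbb P\left(Y_r=\max_{1\le k\le n}Y_k\right)$. *)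

theory Defs
  imports "HOL-Probability.Probability"
begin

text \<open>
  A sample of size \<open>n\<close> is given by the values \<open>x 1, ..., x n\<close> of a function \<open>x :: nat \<Rightarrow> real\<close>.
  All indices are 1-based; \<open>order_stat x n 0 = 0\<close> is a convention, so that the first
  spacing is the distance of the smallest value from the left endpoint \<open>0\<close>.
\<close>

definition order_stat :: "(nat \<Rightarrow> real) \<Rightarrow> nat \<Rightarrow> nat \<Rightarrow> real" where
  "order_stat x n j = (if j = 0 then 0 else sort (map x [1..<Suc n]) ! (j - 1))"

definition spacing :: "(nat \<Rightarrow> real) \<Rightarrow> nat \<Rightarrow> nat \<Rightarrow> real" where
  "spacing x n j = order_stat x n j - order_stat x n (j - 1)"

text \<open>
  For \<open>n \<ge> 1\<close> a maximiser exists because \<open>{1..n}\<close> is finite. If several spacings are maximal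
  (an event of probability zero for a continuous sample), \<open>arg_max_on\<close> selects one of them.
\<close>

definition max_spacing_index :: "(nat \<Rightarrow> real) \<Rightarrow> nat \<Rightarrow> nat" where
  "max_spacing_index x n = arg_max_on (spacing x n) {1..n}"

definition max_spacing_rank :: "(nat \<Rightarrow> real) \<Rightarrow> nat \<Rightarrow> nat" where
  "max_spacing_rank x n = n - max_spacing_index x n + 1"

definition max_spacing_prob :: "'a measure \<Rightarrow> (nat \<Rightarrow> 'a \<Rightarrow> real) \<Rightarrow> nat \<Rightarrow> nat \<Rightarrow> real" where
  "max_spacing_prob M X n r =
     measure M {\<omega> \<in> space M. max_spacing_rank (\<lambda>i. X i \<omega>) n = r}"

definition max_index_prob :: "'a measure \<Rightarrow> (nat \<Rightarrow> 'a \<Rightarrow> real) \<Rightarrow> nat \<Rightarrow> real" where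
  "max_index_prob N Y r = measure N {\<omega> \<in> space N. \<forall>k\<ge>1. Y k \<omega> \<le> Y r \<omega>}"

end

theory Submission
  imports Defs "HOL-Combinatorics.Permutations"
begin

text \<open>
  Sukhatme's representation: almost surely exactly one permutation of the sample is increasing, so
  the law of the spacings is \<open>n!\<close> times the law of the sample restricted to increasing vectors,
  pushed forward under taking differences. This map preserves Lebesgue measure, and on increasing
  vectors \<open>x\<^sub>1 + \<dots> + x\<^sub>n = (\<Sum>j\<le>n. (n - j + 1) (x\<^sub>j - x\<^sub>j\<^sub>-\<^sub>1))\<close>, so the density becomes a
  product of exponential densities with rates \<open>n, \<dots>, 1\<close>. Hence \<open>p\<^sub>r\<^sub>,\<^sub>n\<close> is the probability that
  \<open>Y\<^sub>r\<close> dominates \<open>Y\<^sub>1, \<dots>, Y\<^sub>n\<close>; these events decrease in \<open>n\<close>, which gives the limit. The \<open>p\<^sub>r\<close> sum to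
  \<open>1\<close> because ties have probability zero and \<open>Y\<^sub>k \<rightarrow> 0\<close> almost surely (Borel-Cantelli), so that
  the maximum is attained.
\<close>

section \<open>Independence, joint densities and the absence of ties\<close>

text \<open>Distinct indices have distinct images under \<open>s\<close>, so a product formula over
  the images is one over \<open>J\<close>. Needed for permuted samples, for reversed index order and
  for pairs.\<close>

lemma (in prob_space) indep_vars_reindex_inj:
  assumes inj: "inj_on s I" and ind: "indep_vars (\<lambda>_. borel) X (s ` I)"
  shows "indep_vars (\<lambda>_. borel) (\<lambda>i. X (s i)) I"
proof (unfold indep_vars_def2 indep_sets_def, intro conjI ballI allI impI)
  fix i assume "i \<in> I"
  then show "random_variable borel (X (s i))"
    using ind by (auto simp: indep_vars_def2)
next
  fix i assume "i \<in> I"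
  then show "{X (s i) -` A \<inter> space M |A. A \<in> sets borel} \<subseteq> events"
    using ind by (auto simp: indep_vars_def2 indep_sets_def)
next
  fix J A assume J: "J \<subseteq> I" "J \<noteq> {}" "finite J"
    and A: "A \<in> (\<Pi> i\<in>J. {X (s i) -` A \<inter> space M |A. A \<in> sets borel})"
  have injJ: "inj_on s J" using inj J(1) by (rule inj_on_subset)
  \<comment> \<open>Events indexed by \<open>J\<close> are moved to the image of \<open>J\<close>
    through the inverse of \<open>s\<close>, where the independence of \<open>X\<close>
    applies.\<close>
  let ?B = "\<lambda>k. A (the_inv_into J s k)"
  have B: "?B (s i) = A i" if "i \<in> J" for i using the_inv_into_f_f[OF injJ that] by simp
  have "indep_sets (\<lambda>i. {X i -` A \<inter> space M |A. A \<in> sets borel}) (s ` I)"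
    using ind by (auto simp: indep_vars_def2)
  moreover have "?B \<in> (\<Pi> k\<in>s ` J. {X k -` A \<inter> space M |A. A \<in> sets borel})"
    using A B by (auto simp: Pi_iff)
  ultimately have "prob (\<Inter>k\<in>s ` J. ?B k) = (\<Prod>k\<in>s ` J. prob (?B k))"
    using J by (intro indep_setsD) (auto simp: Pi_iff)
  then show "prob (\<Inter>i\<in>J. A i) = (\<Prod>i\<in>J. prob (A i))"
    by (simp add: prod.reindex[OF injJ] B cong: INF_cong)
qed

text \<open>A product measure is determined by its values on boxes. On a box both the density and
  the indicator factor over the coordinates, so the integral splits into one-dimensional
  ones.\<close>

lemma PiM_density_lborel:
  fixes f :: "'i \<Rightarrow> real \<Rightarrow> real"
  assumes I: "finite I" and f[measurable]: "\<And>i. f i \<in> borel_measurable borel"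
  shows "PiM I (\<lambda>i. density lborel (f i)) =
    density (PiM I (\<lambda>_. lborel)) (\<lambda>x. \<Prod>i\<in>I. ennreal (f i (x i)))"
proof -
  interpret L: product_sigma_finite "\<lambda>_::'i. lborel :: real measure" ..
  \<comment> \<open>Real-valued densities are finite everywhere, which keeps each factor
    sigma-finite.\<close>
  interpret D: product_sigma_finite "\<lambda>i. density lborel (f i)"
    by (auto intro!: product_sigma_finite.intro simp: sigma_finite_measure.sigma_finite_iff_density_finite[OF sigma_finite_lborel])
  show ?thesis
  proof (rule D.PiM_eqI[OF I, symmetric])
    show "sets (density (PiM I (\<lambda>_. lborel)) (\<lambda>x. \<Prod>i\<in>I. ennreal (f i (x i)))) =
        sets (PiM I (\<lambda>i. density lborel (f i)))"
      by (auto intro!: sets_PiM_cong)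
  next
    fix A assume A: "\<And>i. i \<in> I \<Longrightarrow> A i \<in> sets (density lborel (f i))"
    then have [measurable]: "\<And>i. i \<in> I \<Longrightarrow> A i \<in> sets borel" by simp
    have "emeasure (density (PiM I (\<lambda>_. lborel)) (\<lambda>x. \<Prod>i\<in>I. ennreal (f i (x i)))) (Pi\<^sub>E I A)
      = (\<integral>\<^sup>+x. (\<Prod>i\<in>I. ennreal (f i (x i))) * indicator (Pi\<^sub>E I A) x \<partial>PiM I (\<lambda>_. lborel))"
      using I by (intro emeasure_density sets_PiM_I_finite) auto
    also have "\<dots> = (\<integral>\<^sup>+x. (\<Prod>i\<in>I. ennreal (f i (x i)) * indicator (A i) (x i)) \<partial>PiM I (\<lambda>_. lborel))"
    proof (intro nn_integral_cong)
      fix x assume "x \<in> space (PiM I (\<lambda>_. lborel :: real measure))"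
      then have "(indicator (Pi\<^sub>E I A) x :: ennreal) = (\<Prod>i\<in>I. indicator (A i) (x i))"
        using I by (auto simp: indicator_def space_PiM PiE_iff prod_zero_iff intro!: prod.neutral[symmetric])
      then show "(\<Prod>i\<in>I. ennreal (f i (x i))) * indicator (Pi\<^sub>E I A) x =
          (\<Prod>i\<in>I. ennreal (f i (x i)) * indicator (A i) (x i))"
        by (simp add: prod.distrib)
    qed
    also have "\<dots> = (\<Prod>i\<in>I. \<integral>\<^sup>+x. ennreal (f i x) * indicator (A i) x \<partial>lborel)"
      using I by (intro L.product_nn_integral_prod) auto
    also have "\<dots> = (\<Prod>i\<in>I. emeasure (density lborel (f i)) (A i))"
      by (intro prod.cong refl) (simp add: emeasure_density)
    finally show "emeasure (density (PiM I (\<lambda>_. lborel)) (\<lambda>x. \<Prod>i\<in>I. ennreal (f i (x i)))) (Pi\<^sub>E I A)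
      = (\<Prod>i\<in>I. emeasure (density lborel (f i)) (A i))" .
  qed
qed

text \<open>Supplies the joint laws of the permuted samples and of the reversed sequence
  \<open>Y\<close>: independence makes a joint law the product of its marginals.\<close>

lemma (in prob_space) distr_indep_vars_density:
  assumes I: "I \<noteq> {}" and ind: "indep_vars (\<lambda>_. borel) X I"
    and D: "\<And>i. i \<in> I \<Longrightarrow> distributed M lborel (X i) (f i)"
  shows "distr M (PiM I (\<lambda>_. borel)) (\<lambda>\<omega>. \<lambda>i\<in>I. X i \<omega>) = PiM I (\<lambda>i. density lborel (f i))"
proof -
  have rv: "random_variable borel (X i)" if "i \<in> I" for i
    using distributed_measurable[OF D[OF that]] by simp
  have "distr M (PiM I (\<lambda>_. borel)) (\<lambda>\<omega>. \<lambda>i\<in>I. X i \<omega>) = PiM I (\<lambda>i. distr M borel (X i))"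
    using indep_vars_iff_distr_eq_PiM'[OF I, where M' = "\<lambda>_. borel" and X = X] rv ind by blast
  also have "\<dots> = PiM I (\<lambda>i. density lborel (f i))"
  proof (intro PiM_cong refl)
    fix i assume "i \<in> I"
    have "distr M borel (X i) = distr M lborel (X i)" by (rule distr_cong) auto
    with distributed_distr_eq_density[OF D[OF \<open>i \<in> I\<close>]]
    show "distr M borel (X i) = density lborel (f i)" by simp
  qed
  finally show ?thesis .
qed

text \<open>Fubini on the joint law of the pair: every section of the diagonal is a single point,
  which is null for a law with a Lebesgue density.\<close>

lemma (in prob_space) indep_continuous_AE_neq:
  fixes X :: "'i \<Rightarrow> 'a \<Rightarrow> real"
  assumes ind: "indep_vars (\<lambda>_. borel) X I" and ij: "i \<in> I" "j \<in> I" "i \<noteq> j"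
    and D: "distributed M lborel (X j) f"
  shows "AE \<omega> in M. X i \<omega> \<noteq> X j \<omega>"
proof -
  \<comment> \<open>\<open>indep_var\<close> is independence of a family indexed by
    \<open>bool\<close>, so the pair is treated as the reindexed family
    \<open>X (?s b)\<close>.\<close>
  let ?s = "case_bool i j"
  have "inj ?s" using ij(3) by (auto simp: inj_on_def split: bool.splits)
  moreover have "indep_vars (\<lambda>_. borel) X (range ?s)"
    using ij by (intro indep_vars_subset[OF ind]) (auto split: bool.splits)
  ultimately have "indep_vars (\<lambda>_. borel) (\<lambda>b. X (?s b)) UNIV"
    by (rule indep_vars_reindex_inj)
  moreover have "(\<lambda>b. X (?s b)) = case_bool (X i) (X j)" "(\<lambda>_. borel) = case_bool borel borel"
    by (auto split: bool.splits)
  ultimately have "indep_var borel (X i) borel (X j)"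
    unfolding indep_var_def by metis
  then have rv[measurable]: "random_variable borel (X i)" "random_variable borel (X j)"
    and eq: "distr M borel (X i) \<Otimes>\<^sub>M distr M borel (X j) =
      distr M (borel \<Otimes>\<^sub>M borel) (\<lambda>\<omega>. (X i \<omega>, X j \<omega>))"
    unfolding indep_var_distribution_eq by auto
  interpret P: prob_space "distr M borel (X i)" by (rule prob_space_distr) simp
  interpret Q: prob_space "distr M borel (X j)" by (rule prob_space_distr) simp
  interpret PQ: pair_sigma_finite "distr M borel (X i)" "distr M borel (X j)" ..
  have "distr M borel (X j) = distr M lborel (X j)" by (rule distr_cong) auto
  then have Dj: "distr M borel (X j) = density lborel f"
    using distributed_distr_eq_density[OF D] by simp
  have null: "AE y in distr M borel (X j). x \<noteq> y" for x
    unfolding Dj using distributed_borel_measurable[OF D] AE_lborel_singleton[of x] by (simp add: AE_density) (auto elim!: eventually_mono)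
  have "{p \<in> space (borel \<Otimes>\<^sub>M borel). fst p \<noteq> (snd p :: real)} \<in> sets (borel \<Otimes>\<^sub>M borel)"
    by measurable
  then have diag: "{p \<in> space (distr M borel (X i) \<Otimes>\<^sub>M distr M borel (X j)). fst p \<noteq> snd p}
      \<in> sets (distr M borel (X i) \<Otimes>\<^sub>M distr M borel (X j))"
    by (simp add: space_pair_measure)
  have "AE p in distr M borel (X i) \<Otimes>\<^sub>M distr M borel (X j). fst p \<noteq> snd p"
    using null by (intro PQ.AE_pair_measure[OF diag]) simp
  then show ?thesis
    unfolding eq by (subst (asm) AE_distr_iff) auto
qed

section \<open>The difference map and Lebesgue measure\<close>

text \<open>The \<open>0\<close> subtracted at \<open>j = 1\<close> matches the convention
  \<open>order_stat x n 0 = 0\<close>. The restriction makes \<open>diffs n\<close> a map of the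
  product space over \<open>{1..n}\<close> into itself.\<close>

definition diffs :: "nat \<Rightarrow> (nat \<Rightarrow> real) \<Rightarrow> nat \<Rightarrow> real" where
  "diffs n x = (\<lambda>j\<in>{1..n}. x j - (if j = 1 then 0 else x (j - 1)))"

text \<open>Triangular form of the map, which drives the induction in
  \<open>nn_integral_diffs\<close>: a new last coordinate affects only the last difference, and
  there by a shift.\<close>

lemma diffs_Suc:
  "diffs (Suc n) (x(Suc n := y)) = (diffs n x)(Suc n := y - (if n = 0 then 0 else x n))"
  by (auto simp: diffs_def fun_eq_iff)

lemma diffs_cong: "(\<And>i. i \<in> {1..n} \<Longrightarrow> x i = y i) \<Longrightarrow> diffs n x = diffs n y"
  unfolding diffs_def
proof (rule restrict_ext)
  fix j assume j: "j \<in> {1..n}" and eq: "\<And>i. i \<in> {1..n} \<Longrightarrow> x i = y i"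
  have "j - 1 \<in> {1..n}" if "j \<noteq> 1" using j that by auto
  then show "x j - (if j = 1 then 0 else x (j - 1)) = y j - (if j = 1 then 0 else y (j - 1))"
    using eq[OF j] eq[of "j - 1"] by (cases "j = 1") simp_all
qed

lemma measurable_diffs[measurable]:
  "diffs n \<in> measurable (PiM {1..n} (\<lambda>_. borel)) (PiM {1..n} (\<lambda>_. borel))"
  unfolding diffs_def
proof (rule measurable_restrict)
  fix j assume j: "j \<in> {1..n}"
  then have "(\<lambda>x. x (j - 1)) \<in> borel_measurable (PiM {1..n} (\<lambda>_. borel :: real measure))" if "j \<noteq> 1"
    using that by (intro measurable_component_singleton) auto
  with j show "(\<lambda>x. x j - (if j = 1 then 0 else x (j - 1)))
      \<in> borel_measurable (PiM {1..n} (\<lambda>_. borel :: real measure))"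
    by (cases "j = 1") auto
qed

text \<open>The map is triangular with unit diagonal. Fubini takes the place of a Jacobian: with the
  earlier coordinates fixed, the last difference is a translate of the last coordinate, and the
  induction hypothesis treats the others.\<close>

lemma nn_integral_diffs:
  assumes "h \<in> borel_measurable (PiM {1..n} (\<lambda>_. lborel :: real measure))"
  shows "(\<integral>\<^sup>+x. h (diffs n x) \<partial>PiM {1..n} (\<lambda>_. lborel)) = (\<integral>\<^sup>+x. h x \<partial>PiM {1..n} (\<lambda>_. lborel))"
  using assms
proof (induction n arbitrary: h)
  case 0
  show ?case
    by (intro nn_integral_cong) (auto simp: diffs_def space_PiM)
next
  case (Suc n)
  interpret L: product_sigma_finite "\<lambda>_::nat. lborel :: real measure" ..
  let ?L = "\<lambda>n. PiM {1..n} (\<lambda>_. lborel :: real measure)"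
  have ins: "{1..Suc n} = insert (Suc n) {1..n}" by auto
  have "sets (?L m) = sets (PiM {1..m} (\<lambda>_. borel :: real measure))" for m :: nat
    by (rule sets_PiM_cong) auto
  then have meas: "measurable (?L m) (?L m) =
      measurable (PiM {1..m} (\<lambda>_. borel :: real measure)) (PiM {1..m} (\<lambda>_. borel))" for m :: nat
    by (intro measurable_cong_sets)
  have dm[measurable]: "diffs m \<in> measurable (?L m) (?L m)" for m
    unfolding meas by (rule measurable_diffs)
  note h[measurable] = Suc.prems
  have h'[measurable]: "h \<in> borel_measurable (PiM (insert (Suc n) {1..n}) (\<lambda>_. lborel :: real measure))"
    using h unfolding ins .
  have "(\<integral>\<^sup>+x. h (diffs (Suc n) x) \<partial>?L (Suc n)) =
      (\<integral>\<^sup>+x. (\<integral>\<^sup>+y. h (diffs (Suc n) (x(Suc n := y))) \<partial>lborel) \<partial>?L n)"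
    using measurable_compose[OF dm[of "Suc n"] h] unfolding ins
    by (intro L.product_nn_integral_insert) auto
  also have "\<dots> = (\<integral>\<^sup>+x. (\<integral>\<^sup>+y. h ((diffs n x)(Suc n := y)) \<partial>lborel) \<partial>?L n)"
  proof (rule nn_integral_cong)
    fix x assume x: "x \<in> space (?L n)"
    have d: "diffs n x \<in> space (?L n)" using measurable_space[OF dm x] .
    let ?t = "if n = 0 then 0 else x n"
    define k where "k = (\<lambda>y. h ((diffs n x)(Suc n := y)))"
    have "(\<lambda>y. (diffs n x)(Suc n := y)) \<in> measurable lborel (?L (Suc n))"
      unfolding ins using d by (intro measurable_component_update) auto
    from measurable_compose[OF this h] have "k \<in> borel_measurable borel"
      unfolding k_def by (subst (asm) measurable_lborel2)
    \<comment> \<open>Slope \<open>1\<close> and offset \<open>- ?t\<close> give translation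
      invariance; \<open>?t\<close> depends only on the fixed \<open>x\<close>.\<close>
    from nn_integral_real_affine[OF this, of 1 "- ?t"]
    have "(\<integral>\<^sup>+y. k (y - ?t) \<partial>lborel) = (\<integral>\<^sup>+y. k y \<partial>lborel)"
      by simp
    then show "(\<integral>\<^sup>+y. h (diffs (Suc n) (x(Suc n := y))) \<partial>lborel) =
        (\<integral>\<^sup>+y. h ((diffs n x)(Suc n := y)) \<partial>lborel)"
      unfolding diffs_Suc k_def .
  qed
  also have "\<dots> = (\<integral>\<^sup>+x. (\<integral>\<^sup>+y. h (x(Suc n := y)) \<partial>lborel) \<partial>?L n)"
  \<comment> \<open>The induction hypothesis is applied to the inner integral as a function of the
    first \<open>n\<close> coordinates, so its measurability is what remains.\<close>
  proof (rule Suc.IH)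
    have "(\<lambda>(x, y). x(Suc n := y)) \<in> measurable (?L n \<Otimes>\<^sub>M lborel) (?L (Suc n))"
      unfolding ins by (rule measurable_add_dim)
    from measurable_compose[OF this h]
    have "(\<lambda>(x, y). h (x(Suc n := y))) \<in> borel_measurable (?L n \<Otimes>\<^sub>M lborel)"
      by (simp only: split_beta')
    then show "(\<lambda>x. \<integral>\<^sup>+y. h (x(Suc n := y)) \<partial>lborel) \<in> borel_measurable (?L n)"
      by (rule lborel.borel_measurable_nn_integral)
  qed
  also have "\<dots> = (\<integral>\<^sup>+x. h x \<partial>?L (Suc n))"
    using h' unfolding ins by (intro L.product_nn_integral_insert[symmetric]) auto
  finally show ?case .
qed

section \<open>Sorting permutations and spacings\<close>

text \<open>Permuting the indices keeps the multiset of values, and a sorted list is determined by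
  its multiset.\<close>

lemma map_sort_of_permutes:
  assumes s: "s permutes {1..n}" and m: "mono_on {1..n} (\<lambda>i. x (s i) :: real)"
  shows "sort (map x [1..<Suc n]) = map (\<lambda>i. x (s i)) [1..<Suc n]"
proof (rule properties_for_sort)
  have "image_mset s (mset_set {1..n}) = mset_set {1..n}"
    using s by (rule permutes_image_mset) 
  then have "image_mset x (image_mset s (mset_set {1..n})) = image_mset x (mset_set {1..n})"
    by (simp only:)
  then show "mset (map (\<lambda>i. x (s i)) [1..<Suc n]) = mset (map x [1..<Suc n])"
    by (simp del: upt_Suc add: atLeastLessThanSuc_atLeastAtMost multiset.map_comp comp_def)
  show "sorted (map (\<lambda>i. x (s i)) [1..<Suc n])"
    unfolding sorted_map using m
    by (auto simp: sorted_wrt_iff_nth_less mono_on_def simp del: upt_Suc)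
qed

lemma spacing_eq_diffs:
  assumes s: "s permutes {1..n}" and m: "mono_on {1..n} (\<lambda>i. x (s i))"
  shows "(\<lambda>j\<in>{1..n}. spacing x n j) = diffs n (\<lambda>i. x (s i))"
proof -
  \<comment> \<open>List positions start at 0 and sample indices at 1, so position
    \<open>j - 1\<close> carries index \<open>j\<close>.\<close>
  have "order_stat x n j = (if j = 0 then 0 else x (s j))" if "j \<le> n" for j
    using that unfolding order_stat_def map_sort_of_permutes[OF assms] by (auto simp del: upt_Suc)
  then show ?thesis
    by (auto simp: diffs_def spacing_def fun_eq_iff)
qed

text \<open>The witness sends \<open>j\<close> to the entry at position \<open>j - 1\<close> of the
  index list sorted by the key \<open>x\<close>, and fixes everything outside
  \<open>{1..n}\<close>.\<close>

lemma ex_sorting_permutation: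
  fixes x :: "nat \<Rightarrow> real"
  shows "\<exists>s. s permutes {1..n} \<and> mono_on {1..n} (\<lambda>i. x (s i))"
proof -
  define l where "l = sort_key x [1..<Suc n]"
  have l: "set l = {1..n}" "distinct l" "length l = n" "sorted (map x l)"
    by (auto simp: l_def simp del: upt_Suc)
  define s where "s = (\<lambda>j. if j \<in> {1..n} then l ! (j - 1) else j)"
  have "s permutes {1..n}"
  proof (rule bij_imp_permutes)
    have "inj_on s {1..n}"
      using l by (auto simp: s_def inj_on_def nth_eq_iff_index_eq)
    moreover have "s ` {1..n} \<subseteq> {1..n}"
      using l nth_mem[of _ l] by (fastforce simp: s_def)
    ultimately show "bij_betw s {1..n} {1..n}"
      by (simp add: bij_betw_def endo_inj_surj)
  qed (auto simp: s_def)
  moreover have "x (s i) \<le> x (s j)" if "i \<in> {1..n}" "j \<in> {1..n}" "i \<le> j" for i j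
    using sorted_nth_mono[OF l(4), of "i - 1" "j - 1"] that l(3) by (auto simp: s_def)
  ultimately show ?thesis by (auto simp: mono_on_def)
qed

text \<open>Both permutations produce the same sorted list, so \<open>x (s j) = x (t j)\<close>, and
  injectivity cancels \<open>x\<close>.\<close>

lemma sorting_permutation_unique:
  fixes x :: "nat \<Rightarrow> real"
  assumes inj: "inj_on x {1..n}"
    and s: "s permutes {1..n}" "mono_on {1..n} (\<lambda>i. x (s i))"
    and t: "t permutes {1..n}" "mono_on {1..n} (\<lambda>i. x (t i))"
  shows "s = t"
proof
  fix j
  show "s j = t j"
  proof (cases "j \<in> {1..n}")
    case True
    have "map (\<lambda>i. x (s i)) [1..<Suc n] = map (\<lambda>i. x (t i)) [1..<Suc n]"
      using map_sort_of_permutes[OF s] map_sort_of_permutes[OF t] by simp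
    with True have "x (s j) = x (t j)" by (auto simp del: upt_Suc)
    then show ?thesis
      using inj True permutes_in_image[OF s(1)] permutes_in_image[OF t(1)] by (meson inj_onD)
  next
    case False
    then show ?thesis using s(1) t(1) by (simp add: permutes_def)
  qed
qed

section \<open>Exponential densities in terms of differences\<close>

text \<open>Summation by parts: the \<open>j\<close>-th difference contributes to \<open>x i\<close>
  exactly for \<open>i\<close> from \<open>j\<close> to \<open>n\<close>. These multiplicities
  become the exponential rates.\<close>

lemma sum_diffs: "(\<Sum>i\<in>{1..n}. x i) = (\<Sum>j\<in>{1..n}. real (n - j + 1) * diffs n x j)"
proof (induction n arbitrary: x)
  case (Suc n)
  have d: "diffs (Suc n) x j = diffs n x j" if "j \<in> {1..n}" for j
    using that by (auto simp: diffs_def)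
  have tel: "x (Suc n) = (\<Sum>j\<in>{1..Suc n}. diffs (Suc n) x j)"
  proof -
    have "(\<Sum>j\<in>{1..m}. x j - (if j = 1 then 0 else x (j - 1))) = (if m = 0 then 0 else x m)" for m
      by (induction m) auto
    from this[of "Suc n"] show ?thesis by (simp only: diffs_def restrict_apply cong: sum.cong) simp
  qed
  \<comment> \<open>Adding the telescoped \<open>x (Suc n)\<close> raises every old coefficient by
    one and gives the new difference the coefficient 1.\<close>
  have "(\<Sum>i\<in>{1..Suc n}. x i) = (\<Sum>j\<in>{1..n}. real (n - j + 1) * diffs n x j) + (\<Sum>j\<in>{1..Suc n}. diffs (Suc n) x j)"
    using Suc.IH[of x] tel by simp
  also have "\<dots> = (\<Sum>j\<in>{1..n}. real (n - j + 1) * diffs (Suc n) x j + diffs (Suc n) x j) + diffs (Suc n) x (Suc n)"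
    by (simp add: d sum.distrib)
  also have "\<dots> = (\<Sum>j\<in>{1..n}. real (Suc n - j + 1) * diffs (Suc n) x j) + diffs (Suc n) x (Suc n)"
    by (auto intro!: sum.cong simp: algebra_simps Suc_diff_le)
  finally show ?case by simp
qed simp

text \<open>Matches supports: exponential densities vanish at negative arguments, so this locates
  where the product density of the differences can be nonzero.\<close>

lemma diffs_nonneg_iff:
  "(\<forall>i\<in>{1..n}. 0 \<le> diffs n x i) \<longleftrightarrow> (\<forall>i\<in>{1..n}. 0 \<le> x i) \<and> mono_on {1..n} x"
proof
  assume R: "(\<forall>i\<in>{1..n}. 0 \<le> x i) \<and> mono_on {1..n} x"
  then have "x (i - 1) \<le> x i" if "i \<in> {1..n}" "i \<noteq> 1" for i
    using that by (auto intro!: mono_onD[of "{1..n}" x])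
  with R show "\<forall>i\<in>{1..n}. 0 \<le> diffs n x i" by (auto simp: diffs_def)
next
  assume L: "\<forall>i\<in>{1..n}. 0 \<le> diffs n x i"
  have L_step: "x i \<le> x (Suc i)" if "1 \<le> i" "Suc i \<le> n" for i
    using L[rule_format, of "Suc i"] that by (auto simp: diffs_def)
  have le: "x i \<le> x j" if "1 \<le> i" "i \<le> j" "j \<le> n" for i j
    using that(2,1,3) proof (induction j rule: dec_induct)
    case (step j)
    then show ?case using L_step[of j] by (auto intro: order_trans)
  qed auto
  have "0 \<le> x 1" if "1 \<le> n"
    using L[rule_format, of 1] that by (auto simp: diffs_def)
  then have "0 \<le> x i" if "i \<in> {1..n}" for i
    using le[of 1 i] that by fastforce
  with le show "(\<forall>i\<in>{1..n}. 0 \<le> x i) \<and> mono_on {1..n} x"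
    by (auto intro!: mono_onI)
qed

text \<open>On the common support the rates multiply to \<open>fact n\<close> and the exponents add
  up by \<open>sum_diffs\<close>. Off it, the left side has a factor zero, and on the right either
  monotonicity fails or some coordinate is negative.\<close>

lemma prod_exponential_density_diffs:
  "(\<Prod>j\<in>{1..n}. exponential_density (real (n - j + 1)) (diffs n x j)) =
    fact n * (if mono_on {1..n} x then \<Prod>i\<in>{1..n}. exponential_density 1 (x i) else 0)"
proof (cases "\<forall>i\<in>{1..n}. 0 \<le> diffs n x i")
  case True
  have f: "(\<Prod>j\<in>{1..n}. real (n - j + 1)) = fact n"
  proof -
    have "(\<Prod>j\<in>{1..n}. real (n - j + 1)) = (\<Prod>j\<in>{1..n}. real j)"
      by (rule prod.reindex_bij_witness[of _ "\<lambda>j. n - j + 1" "\<lambda>j. n - j + 1"]) auto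
    then show ?thesis by (simp add: fact_prod)
  qed
  have "(\<Prod>j\<in>{1..n}. exponential_density (real (n - j + 1)) (diffs n x j)) =
      (\<Prod>j\<in>{1..n}. real (n - j + 1) * exp (- (real (n - j + 1) * diffs n x j)))"
  proof (intro prod.cong refl)
    fix j assume "j \<in> {1..n}"
    then have "\<not> diffs n x j < 0" using True by force
    then show "exponential_density (real (n - j + 1)) (diffs n x j) =
        real (n - j + 1) * exp (- (real (n - j + 1) * diffs n x j))"
      unfolding exponential_density_def by (simp add: mult.commute)
  qed
  also have "\<dots> = fact n * exp (- (\<Sum>i\<in>{1..n}. x i))"
    unfolding prod.distrib f sum_diffs[of x n] by (simp only: exp_sum[symmetric] sum_negf finite_atLeastAtMost)
  also have "exp (- (\<Sum>i\<in>{1..n}. x i)) = (\<Prod>i\<in>{1..n}. exponential_density 1 (x i))"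
    unfolding sum_negf[symmetric] exp_sum[OF finite_atLeastAtMost]
    using True[unfolded diffs_nonneg_iff]
    by (intro prod.cong refl) (auto simp: exponential_density_def not_less[symmetric])
  finally show ?thesis
    using True[unfolded diffs_nonneg_iff] by simp
next
  case False
  then have "\<not> ((\<forall>i\<in>{1..n}. 0 \<le> x i) \<and> mono_on {1..n} x)"
    unfolding diffs_nonneg_iff .
  then have "(if mono_on {1..n} x then \<Prod>i\<in>{1..n}. exponential_density 1 (x i) else 0) = 0"
    by (auto simp: exponential_density_def not_le)
  moreover have "(\<Prod>j\<in>{1..n}. exponential_density (real (n - j + 1)) (diffs n x j)) = 0"
    using False by (auto simp: exponential_density_def not_le)
  ultimately show ?thesis by simp
qed

section \<open>Sukhatme's representation of the spacings\<close>

lemma emeasure_distr_nn_integral: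
  assumes f: "f \<in> measurable M N" and A: "A \<in> sets N"
  shows "emeasure (distr M N f) A = (\<integral>\<^sup>+x. indicator A (f x) \<partial>M)"
  using nn_integral_distr[OF f, of "indicator A"] A by simp

text \<open>Measurability is a separate conclusion because reading probabilities of the spacings off
  their law requires it.\<close>

theorem (in prob_space) sukhatme:
  fixes X :: "nat \<Rightarrow> 'a \<Rightarrow> real"
  assumes n: "1 \<le> n" and ind: "indep_vars (\<lambda>_. borel) X {1..n}"
    and D: "\<And>i. i \<in> {1..n} \<Longrightarrow> distributed M lborel (X i) (exponential_density 1)"
  shows "random_variable (PiM {1..n} (\<lambda>_. borel)) (\<lambda>\<omega>. \<lambda>j\<in>{1..n}. spacing (\<lambda>i. X i \<omega>) n j)"
    (is "random_variable ?B ?S")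
    and "distr M (PiM {1..n} (\<lambda>_. borel)) (\<lambda>\<omega>. \<lambda>j\<in>{1..n}. spacing (\<lambda>i. X i \<omega>) n j) =
      PiM {1..n} (\<lambda>j. density lborel (exponential_density (real (n - j + 1))))" (is "_ = ?\<nu>")
proof -
  let ?L = "PiM {1..n} (\<lambda>_. lborel :: real measure)"
  let ?P = "{s. s permutes {1..n}}"
  let ?\<mu> = "PiM {1..n} (\<lambda>_. density lborel (exponential_density 1))"
  \<comment> \<open>\<open>T s\<close> is the sample rearranged by \<open>s\<close>,
    \<open>V\<close> the cone of increasing vectors, and \<open>G A\<close> the part of this cone
    whose differences lie in \<open>A\<close>.\<close>
  define T where "T = (\<lambda>s \<omega>. \<lambda>i\<in>{1..n}. X (s i) \<omega>)"
  define V where "V = {x \<in> space ?B. mono_on {1..n} x}"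
  define G where "G = (\<lambda>A. V \<inter> (diffs n -` A \<inter> space ?B))"
  have finP: "finite ?P" by (simp add: finite_permutations)
  have setsL: "sets ?L = sets ?B" by (rule sets_PiM_cong) auto
  have rv: "random_variable borel (X i)" if "i \<in> {1..n}" for i
    using distributed_measurable[OF D[OF that]] by simp
  have T_meas: "random_variable ?B (T s)" if "s \<in> ?P" for s
    unfolding T_def using that permutes_in_image[of s "{1..n}"]
    by (intro measurable_restrict rv) auto
  have T_space: "T s \<omega> \<in> space ?B" for s \<omega>
    by (simp add: T_def space_PiM)
  have V_meas: "V \<in> sets ?B"
  proof -
    have "V = {x \<in> space ?B. \<forall>i\<in>{1..n}. \<forall>j\<in>{1..n}. i \<le> j \<longrightarrow> x i \<le> x j}"
      by (auto simp: V_def mono_on_def)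
    also have "\<dots> \<in> sets ?B"
      by (intro sets.sets_Collect_finite_All sets.sets_Collect_imp finite_atLeastAtMost
            borel_measurable_le measurable_component_singleton sets.sets_Collect_const)
    finally show ?thesis .
  qed
  have G_meas: "G A \<in> sets ?B" if "A \<in> sets ?B" for A
    unfolding G_def using V_meas measurable_sets[OF measurable_diffs that] by auto
  have T_V: "T s \<omega> \<in> V \<longleftrightarrow> mono_on {1..n} (\<lambda>i. X (s i) \<omega>)" for s \<omega>
    using T_space[of s \<omega>] by (simp add: V_def T_def mono_on_def)
  have S_T: "?S \<omega> = diffs n (T s \<omega>)" if "s \<in> ?P" "T s \<omega> \<in> V" for s \<omega>
  proof -
    have "?S \<omega> = diffs n (\<lambda>i. X (s i) \<omega>)"
      using that(1) by (intro spacing_eq_diffs that(2)[unfolded T_V]) simp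
    also have "\<dots> = diffs n (T s \<omega>)" by (intro diffs_cong) (simp add: T_def)
    finally show ?thesis .
  qed
  have ex: "\<exists>s\<in>?P. T s \<omega> \<in> V" for \<omega>
    unfolding T_V using ex_sorting_permutation[of n "\<lambda>i. X i \<omega>"] by blast
  \<comment> \<open>This holds for every outcome, ties included: some rearrangement is increasing,
    and each increasing one yields the same spacings. Measurability thus reduces to a finite
    union.\<close>
  have S_vimage: "?S -` A \<inter> space M = (\<Union>s\<in>?P. T s -` G A \<inter> space M)" for A
    using ex S_T T_space unfolding G_def by fastforce
  show S_meas: "random_variable ?B ?S"
  proof (rule measurableI)
    show "?S \<omega> \<in> space ?B" for \<omega> by (simp add: space_PiM)
    show "?S -` A \<inter> space M \<in> events" if "A \<in> sets ?B" for A
      unfolding S_vimage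
      using finP measurable_sets[OF T_meas G_meas[OF that]] by (intro sets.finite_UN) auto
  qed
  have law: "distr M ?B (T s) = ?\<mu>" if "s \<in> ?P" for s
    unfolding T_def
  proof (rule distr_indep_vars_density)
    have s: "s permutes {1..n}" using that by simp
    show "indep_vars (\<lambda>_. borel) (\<lambda>i. X (s i)) {1..n}"
      using indep_vars_reindex_inj[of s "{1..n}" X] ind permutes_inj_on[OF s]
      unfolding permutes_image[OF s] by blast
    show "distributed M lborel (X (s i)) (exponential_density 1)" if "i \<in> {1..n}" for i
      using that permutes_in_image[OF s] by (intro D) auto
  qed (use n in auto)
  have "AE \<omega> in M. \<forall>i\<in>{1..n}. \<forall>j\<in>{1..n}. i \<noteq> j \<longrightarrow> X i \<omega> \<noteq> X j \<omega>"
    using indep_continuous_AE_neq[OF ind _ _ _ D] by (intro AE_finite_allI) auto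
  then have distinct: "AE \<omega> in M. inj_on (\<lambda>i. X i \<omega>) {1..n}"
    by eventually_elim (auto simp: inj_on_def)
  have \<mu>: "?\<mu> = density ?L (\<lambda>x. \<Prod>i\<in>{1..n}. ennreal (exponential_density 1 (x i)))"
    by (rule PiM_density_lborel) auto
  have \<nu>: "?\<nu> = density ?L (\<lambda>x. \<Prod>j\<in>{1..n}. ennreal (exponential_density (real (n - j + 1)) (x j)))"
    by (rule PiM_density_lborel) auto
  have nonneg: "0 \<le> exponential_density l y" if "0 < l" for l y
    using that by (simp add: exponential_density_def)
  have meas_prod: "(\<lambda>x. \<Prod>i\<in>{1..n}. ennreal (exponential_density (l i) (x i))) \<in> borel_measurable ?L" for l
    by (intro borel_measurable_prod_ennreal measurable_compose[OF measurable_component_singleton]) auto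
  \<comment> \<open>The density identity carried over to \<open>ennreal\<close>, with the indicator
    of \<open>V\<close> replacing the case distinction.\<close>
  have key: "fact n * (indicator V x * (\<Prod>i\<in>{1..n}. ennreal (exponential_density 1 (x i)))) =
      (\<Prod>j\<in>{1..n}. ennreal (exponential_density (real (n - j + 1)) (diffs n x j)))"
    if "x \<in> space ?B" for x
  proof -
    have "(\<Prod>j\<in>{1..n}. ennreal (exponential_density (real (n - j + 1)) (diffs n x j))) =
      ennreal (\<Prod>j\<in>{1..n}. exponential_density (real (n - j + 1)) (diffs n x j))"
      by (intro prod_ennreal nonneg) simp
    also have "\<dots> = ennreal (fact n) *
        ennreal (if mono_on {1..n} x then \<Prod>i\<in>{1..n}. exponential_density 1 (x i) else 0)"
      unfolding prod_exponential_density_diffs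
      by (intro ennreal_mult) (auto intro!: prod_nonneg nonneg)
    also have "ennreal (fact n) = fact n"
      by (metis ennreal_of_nat_eq_real_of_nat of_nat_fact)
    also have "ennreal (if mono_on {1..n} x then \<Prod>i\<in>{1..n}. exponential_density 1 (x i) else 0) =
        indicator V x * (\<Prod>i\<in>{1..n}. ennreal (exponential_density 1 (x i)))"
      using that nonneg[of 1] by (simp add: V_def prod_ennreal)
    finally show ?thesis by simp
  qed
  show "distr M ?B ?S = ?\<nu>"
  proof (rule measure_eqI)
    show "sets (distr M ?B ?S) = sets ?\<nu>" by (simp, rule sets_PiM_cong) auto
  next
    fix A assume "A \<in> sets (distr M ?B ?S)"
    then have A: "A \<in> sets ?B" by simp
    have GA: "G A \<in> sets ?B" using A by (rule G_meas)
    have "emeasure (distr M ?B ?S) A = (\<integral>\<^sup>+\<omega>. indicator A (?S \<omega>) \<partial>M)"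
      by (rule emeasure_distr_nn_integral[OF S_meas A])
    also have "\<dots> = (\<integral>\<^sup>+\<omega>. (\<Sum>s\<in>?P. indicator (G A) (T s \<omega>)) \<partial>M)"
    \<comment> \<open>Ties have to be excluded here: without them only the unique sorting
      permutation can contribute to the sum, so nothing is counted twice.\<close>
    proof (rule nn_integral_cong_AE, use distinct in eventually_elim)
      fix \<omega> assume inj: "inj_on (\<lambda>i. X i \<omega>) {1..n}"
      obtain s where s: "s \<in> ?P" "T s \<omega> \<in> V" using ex by blast
      have "T t \<omega> \<notin> V" if "t \<in> ?P - {s}" for t
        using sorting_permutation_unique[OF inj, of s t] s that unfolding T_V by auto
      then have "(\<Sum>t\<in>?P - {s}. indicator (G A) (T t \<omega>)) = (0 :: ennreal)"
        by (intro sum.neutral) (auto simp: G_def)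
      then have "(\<Sum>t\<in>?P. indicator (G A) (T t \<omega>)) = (indicator (G A) (T s \<omega>) :: ennreal)"
        by (subst sum.remove[OF finP s(1)]) simp
      also have "\<dots> = indicator A (?S \<omega>)"
        using S_T[OF s] s(2) T_space[of s \<omega>] by (auto simp: G_def indicator_def)
      finally show "indicator A (?S \<omega>) = (\<Sum>s\<in>?P. indicator (G A) (T s \<omega>) :: ennreal)" ..
    qed
    also have "\<dots> = (\<Sum>s\<in>?P. \<integral>\<^sup>+\<omega>. indicator (G A) (T s \<omega>) \<partial>M)"
      using measurable_compose[OF T_meas borel_measurable_indicator[OF GA]]
      by (intro nn_integral_sum) auto
    also have "\<dots> = (\<Sum>s\<in>?P. emeasure ?\<mu> (G A))"
    proof (rule sum.cong[OF refl])
      fix s assume s: "s \<in> ?P"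
      have "(\<integral>\<^sup>+\<omega>. indicator (G A) (T s \<omega>) \<partial>M) = emeasure (distr M ?B (T s)) (G A)"
        by (rule emeasure_distr_nn_integral[OF T_meas[OF s] GA, symmetric])
      then show "(\<integral>\<^sup>+\<omega>. indicator (G A) (T s \<omega>) \<partial>M) = emeasure ?\<mu> (G A)"
        unfolding law[OF s] .
    qed
    also have "\<dots> = fact n * emeasure ?\<mu> (G A)"
      by (simp add: card_permutations)
    also have "\<dots> = fact n * (\<integral>\<^sup>+x. (\<Prod>i\<in>{1..n}. ennreal (exponential_density 1 (x i))) * indicator (G A) x \<partial>?L)"
      unfolding \<mu> using GA meas_prod by (subst emeasure_density) (auto simp: setsL)
    also have "\<dots> = (\<integral>\<^sup>+x. fact n * ((\<Prod>i\<in>{1..n}. ennreal (exponential_density 1 (x i))) * indicator (G A) x) \<partial>?L)"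
      using GA meas_prod
      by (intro nn_integral_cmult[symmetric] borel_measurable_times borel_measurable_indicator) (auto simp: setsL)
    also have "\<dots> = (\<integral>\<^sup>+x. (\<Prod>j\<in>{1..n}. ennreal (exponential_density (real (n - j + 1)) (diffs n x j))) *
        indicator A (diffs n x) \<partial>?L)"
    proof (rule nn_integral_cong)
      fix x assume "x \<in> space ?L"
      then have x: "x \<in> space ?B" by (simp add: space_PiM)
      then have "(indicator (G A) x :: ennreal) = indicator V x * indicator A (diffs n x)"
        by (auto simp: G_def indicator_def)
      then show "fact n * ((\<Prod>i\<in>{1..n}. ennreal (exponential_density 1 (x i))) * indicator (G A) x) =
          (\<Prod>j\<in>{1..n}. ennreal (exponential_density (real (n - j + 1)) (diffs n x j))) * indicator A (diffs n x)"
        unfolding key[OF x, symmetric] by (simp only: mult_ac)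
    qed
    \<comment> \<open>The integrand now depends on \<open>x\<close> only through
      \<open>diffs n x\<close>, so measure preservation allows \<open>x\<close> in its
      place.\<close>
    also have "\<dots> = (\<integral>\<^sup>+x. (\<Prod>j\<in>{1..n}. ennreal (exponential_density (real (n - j + 1)) (x j))) * indicator A x \<partial>?L)"
      using A meas_prod
      by (intro nn_integral_diffs[where h = "\<lambda>x. (\<Prod>j\<in>{1..n}. ennreal (exponential_density (real (n - j + 1)) (x j))) * indicator A x"]
          borel_measurable_times borel_measurable_indicator) (auto simp: setsL)
    also have "\<dots> = emeasure ?\<nu> A"
      unfolding \<nu> using A meas_prod by (intro emeasure_density[symmetric]) (auto simp: setsL)
    finally show "emeasure (distr M ?B ?S) A = emeasure ?\<nu> A" .
  qed
qed

section \<open>The position of the maximum and the law of the rank\<close>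

text \<open>Exhibits the choice as a function of the set of maximisers alone; congruence and
  measurability rest on this form.\<close>

lemma arg_max_on_eq_Eps:
  fixes f :: "'i \<Rightarrow> real"
  shows "arg_max_on f I = (SOME i. i \<in> {i\<in>I. \<forall>k\<in>I. f k \<le> f i})"
  unfolding arg_max_on_def arg_max_def is_arg_max_def by (rule arg_cong[of _ _ Eps]) (auto simp: not_less)

lemma arg_max_on_cong:
  fixes f g :: "'i \<Rightarrow> real"
  assumes "\<And>i. i \<in> I \<Longrightarrow> f i = g i"
  shows "arg_max_on f I = arg_max_on g I"
proof -
  have "{i\<in>I. \<forall>k\<in>I. f k \<le> f i} = {i\<in>I. \<forall>k\<in>I. g k \<le> g i}"
    using assms by auto
  then show ?thesis unfolding arg_max_on_eq_Eps by simp
qed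

lemma arg_max_on_maximal:
  fixes f :: "'i \<Rightarrow> real"
  assumes I: "finite I" "I \<noteq> {}"
  shows "arg_max_on f I \<in> {i\<in>I. \<forall>k\<in>I. f k \<le> f i}"
proof -
  have "Max (f ` I) \<in> f ` I" using I by (intro Max_in) auto
  then obtain m where m: "m \<in> I" "f m = Max (f ` I)" by force
  then have "\<forall>k\<in>I. f k \<le> f m" using I by simp
  with m(1) have "m \<in> {i\<in>I. \<forall>k\<in>I. f k \<le> f i}" by simp
  then show ?thesis
    unfolding arg_max_on_eq_Eps by (rule someI)
qed

lemma arg_max_on_eq_iff:
  fixes f :: "'i \<Rightarrow> real"
  assumes I: "finite I" "I \<noteq> {}" and inj: "inj_on f I" and j: "j \<in> I"
  shows "arg_max_on f I = j \<longleftrightarrow> (\<forall>k\<in>I. f k \<le> f j)"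
proof -
  let ?a = "arg_max_on f I"
  have a: "?a \<in> I" "\<forall>k\<in>I. f k \<le> f ?a"
    using arg_max_on_maximal[OF I, of f] by auto
  show ?thesis
  proof
    assume "?a = j"
    with a(2) show "\<forall>k\<in>I. f k \<le> f j" by simp
  next
    assume "\<forall>k\<in>I. f k \<le> f j"
    with a j have "f ?a = f j" by (intro order.antisym) auto
    then show "?a = j" by (rule inj_onD[OF inj _ a(1) j])
  qed
qed

text \<open>The set of maximisers takes finitely many values, each on an event given by finitely
  many comparisons. Whatever element is then chosen from it, a function on a finite discrete space
  is measurable.\<close>

lemma measurable_arg_max_on:
  assumes I: "finite (I :: 'i set)"
  shows "(\<lambda>x. arg_max_on x I) \<in> measurable (PiM I (\<lambda>_. borel :: real measure)) (count_space UNIV)"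
proof -
  let ?B = "PiM I (\<lambda>_. borel :: real measure)"
  let ?m = "\<lambda>x. {i\<in>I. \<forall>k\<in>I. x k \<le> (x i :: real)}"
  have "?m \<in> measurable ?B (count_space (Pow I))"
    unfolding measurable_count_space_eq2[OF finite_Pow_iff[THEN iffD2, OF I]]
  proof (intro conjI ballI)
    fix A assume A: "A \<in> Pow I"
    have "?m -` {A} \<inter> space ?B =
      {x \<in> space ?B. (\<forall>i\<in>A. \<forall>k\<in>I. x k \<le> x i) \<and> (\<forall>i\<in>I - A. \<exists>k\<in>I. x i < x k)}"
      using A by (auto simp: set_eq_iff not_less[symmetric])
    also have "\<dots> \<in> sets ?B"
      using I A finite_subset[of A I]
      by (intro sets.sets_Collect_conj sets.sets_Collect_finite_All sets.sets_Collect_finite_Ex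
            borel_measurable_le borel_measurable_less measurable_component_singleton) auto
    finally show "?m -` {A} \<inter> space ?B \<in> sets ?B" .
  qed auto
  then have "(\<lambda>x. SOME i. i \<in> ?m x) \<in> measurable ?B (count_space UNIV)"
    by (rule measurable_compose) auto
  then show ?thesis unfolding arg_max_on_eq_Eps .
qed

text \<open>The rank is a measurable function of the spacing vector, which has the law of
  \<open>Y\<close> read backwards; rank \<open>r\<close> sits at position \<open>n - r + 1\<close>,
  where that vector carries \<open>Y r\<close>.\<close>

lemma max_spacing_prob_eq:
  fixes X :: "nat \<Rightarrow> 'a \<Rightarrow> real" and Y :: "nat \<Rightarrow> 'b \<Rightarrow> real"
  assumes M: "prob_space M" "prob_space.indep_vars M (\<lambda>_. borel) X {1..n}"
      "\<And>i. i \<in> {1..n} \<Longrightarrow> distributed M lborel (X i) (exponential_density 1)"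
    and N: "prob_space N" "prob_space.indep_vars N (\<lambda>_. borel) Y {1..n}"
      "\<And>r. r \<in> {1..n} \<Longrightarrow> distributed N lborel (Y r) (exponential_density (real r))"
    and r: "r \<in> {1..n}"
  shows "max_spacing_prob M X n r = measure N {\<omega> \<in> space N. \<forall>k\<in>{1..n}. Y k \<omega> \<le> Y r \<omega>}"
proof -
  interpret M: prob_space M by fact
  interpret N: prob_space N by fact
  let ?B = "PiM {1..n} (\<lambda>_. borel :: real measure)"
  let ?\<nu> = "PiM {1..n} (\<lambda>j. density lborel (exponential_density (real (n - j + 1))))"
  let ?S = "\<lambda>\<omega>. \<lambda>j\<in>{1..n}. spacing (\<lambda>i. X i \<omega>) n j"
  \<comment> \<open>Spacing \<open>j\<close> has rate \<open>n - j + 1\<close>, hence the reversed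
    index.\<close>
  let ?T = "\<lambda>\<omega>. \<lambda>j\<in>{1..n}. Y (n - j + 1) \<omega>"
  define A where "A = {z \<in> space ?B. n - arg_max_on z {1..n} + 1 = r}"
  have n: "1 \<le> n" using r by simp
  have A: "A \<in> sets ?B"
  proof -
    have "A = (\<lambda>z. arg_max_on z {1..n}) -` {a. n - a + 1 = r} \<inter> space ?B"
      by (auto simp: A_def)
    also have "\<dots> \<in> sets ?B"
      by (rule measurable_sets[OF measurable_arg_max_on]) auto
    finally show ?thesis .
  qed
  have rev: "(\<lambda>j. n - j + 1) ` {1..n} = {1..n}"
  proof (intro equalityI subsetI)
    fix k assume "k \<in> {1..n}"
    then show "k \<in> (\<lambda>j. n - j + 1) ` {1..n}"
      by (intro image_eqI[of _ _ "n - k + 1"]) auto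
  qed auto
  have inj_rev: "inj_on (\<lambda>j. n - j + 1) {1..n}"
    by (auto simp: inj_on_def)
  have rv: "Y k \<in> borel_measurable N" if "k \<in> {1..n}" for k
    using distributed_measurable[OF N(3)[OF that]] by simp
  have T_meas: "?T \<in> measurable N ?B"
    by (intro measurable_restrict rv) auto
  have lawT: "distr N ?B ?T = ?\<nu>"
  proof (rule N.distr_indep_vars_density)
    show "N.indep_vars (\<lambda>_. borel) (\<lambda>j. Y (n - j + 1)) {1..n}"
      using N.indep_vars_reindex_inj[OF inj_rev, of Y] N(2) unfolding rev by simp
    show "distributed N lborel (Y (n - j + 1)) (exponential_density (real (n - j + 1)))"
      if "j \<in> {1..n}" for j
      using that by (intro N(3)) auto
  qed (use n in auto)
  note S = M.sukhatme[OF n M(2,3)]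
  have "max_spacing_prob M X n r = M.prob (?S -` A \<inter> space M)"
  proof -
    have "arg_max_on (?S \<omega>) {1..n} = max_spacing_index (\<lambda>i. X i \<omega>) n" for \<omega>
      unfolding max_spacing_index_def by (rule arg_max_on_cong) simp
    then show ?thesis
      using measurable_space[OF S(1)]
      unfolding max_spacing_prob_def max_spacing_rank_def A_def
      by (intro arg_cong[of _ _ M.prob]) auto
  qed
  also have "\<dots> = measure (distr M ?B ?S) A"
    by (rule measure_distr[OF S(1) A, symmetric])
  also have "\<dots> = measure (distr N ?B ?T) A"
    by (rule arg_cong[of _ _ "\<lambda>P. measure P A"]) (rule trans[OF S(2) lawT[symmetric]])
  also have "\<dots> = N.prob (?T -` A \<inter> space N)"
    by (rule measure_distr[OF T_meas A])
  also have "\<dots> = N.prob {\<omega> \<in> space N. \<forall>k\<in>{1..n}. Y k \<omega> \<le> Y r \<omega>}"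
  \<comment> \<open>The two events can differ only on ties, where the chosen maximiser need not be
    the index \<open>r\<close>.\<close>
  proof (rule N.finite_measure_eq_AE)
    have "AE \<omega> in N. \<forall>i\<in>{1..n}. \<forall>j\<in>{1..n}. i \<noteq> j \<longrightarrow> Y i \<omega> \<noteq> Y j \<omega>"
      using N.indep_continuous_AE_neq[OF N(2) _ _ _ N(3)] by (intro AE_finite_allI) auto
    then show "AE \<omega> in N. \<omega> \<in> ?T -` A \<inter> space N \<longleftrightarrow>
        \<omega> \<in> {\<omega> \<in> space N. \<forall>k\<in>{1..n}. Y k \<omega> \<le> Y r \<omega>}"
    proof eventually_elim
      fix \<omega> assume distinct: "\<forall>i\<in>{1..n}. \<forall>j\<in>{1..n}. i \<noteq> j \<longrightarrow> Y i \<omega> \<noteq> Y j \<omega>"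
      have inj: "inj_on (?T \<omega>) {1..n}"
      proof (rule inj_onI, rule ccontr)
        fix i j assume ij: "i \<in> {1..n}" "j \<in> {1..n}" "?T \<omega> i = ?T \<omega> j" "i \<noteq> j"
        then have "n - i + 1 \<in> {1..n}" "n - j + 1 \<in> {1..n}" "n - i + 1 \<noteq> n - j + 1" by auto
        with distinct have "Y (n - i + 1) \<omega> \<noteq> Y (n - j + 1) \<omega>" by blast
        with ij show False by simp
      qed
      let ?a = "arg_max_on (?T \<omega>) {1..n}"
      note iff = arg_max_on_eq_iff[OF finite_atLeastAtMost _ inj]
      have ne: "{1..n} \<noteq> {}" using n by auto
      have j: "n - r + 1 \<in> {1..n}" using r by auto
      have a: "?a \<in> {1..n}" using arg_max_on_maximal[OF finite_atLeastAtMost ne, of "?T \<omega>"] by blast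
      have "n - ?a + 1 = r \<longleftrightarrow> ?a = n - r + 1"
      proof -
        \<comment> \<open>Subtraction on \<open>nat\<close> truncates, so \<open>b\<close> must be
          known to lie in \<open>{1..n}\<close>.\<close>
        have "n - b + 1 = r \<longleftrightarrow> b = n - r + 1" if "b \<in> {1..n}" for b
          using that r by auto
        from this[OF a] show ?thesis .
      qed
      also have "\<dots> \<longleftrightarrow> (\<forall>k\<in>{1..n}. ?T \<omega> k \<le> ?T \<omega> (n - r + 1))"
        by (rule iff[OF ne j])
      also have "\<dots> \<longleftrightarrow> (\<forall>k\<in>{1..n}. Y (n - k + 1) \<omega> \<le> Y r \<omega>)"
      proof -
        have "n - (n - r + 1) + 1 = r" using r by auto
        with j have "?T \<omega> (n - r + 1) = Y r \<omega>" by simp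
        then show ?thesis by simp
      qed
      also have "\<dots> \<longleftrightarrow> (\<forall>k\<in>(\<lambda>j. n - j + 1) ` {1..n}. Y k \<omega> \<le> Y r \<omega>)"
        by simp
      also have "\<dots> \<longleftrightarrow> (\<forall>k\<in>{1..n}. Y k \<omega> \<le> Y r \<omega>)"
        unfolding rev ..
      finally show "\<omega> \<in> ?T -` A \<inter> space N \<longleftrightarrow>
          \<omega> \<in> {\<omega> \<in> space N. \<forall>k\<in>{1..n}. Y k \<omega> \<le> Y r \<omega>}"
        using measurable_space[OF T_meas] by (auto simp: A_def)
    qed
    show "?T -` A \<inter> space N \<in> N.events" by (rule measurable_sets[OF T_meas A])
    show "{\<omega> \<in> space N. \<forall>k\<in>{1..n}. Y k \<omega> \<le> Y r \<omega>} \<in> N.events"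
      using rv r by (intro sets.sets_Collect_finite_All borel_measurable_le) auto
  qed
  finally show ?thesis .
qed

section \<open>The exponential sequence: limit and positivity\<close>

text \<open>Weierstrass' product inequality: the partial product is at most 1, so multiplying it by
  \<open>1 - f i\<close> costs at most \<open>f i\<close>.\<close>

lemma prod_one_minus_ge:
  fixes f :: "'i \<Rightarrow> real"
  assumes "finite I" "\<And>i. i \<in> I \<Longrightarrow> 0 \<le> f i \<and> f i \<le> 1"
  shows "1 - (\<Sum>i\<in>I. f i) \<le> (\<Prod>i\<in>I. 1 - f i)"
  using assms
proof (induction I)
  case (insert i I)
  have "(\<Prod>i\<in>I. 1 - f i) \<le> 1"
    using insert.prems by (intro prod_le_1) auto
  then have "f i * (\<Prod>i\<in>I. 1 - f i) \<le> f i"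
    using insert.prems by (simp add: mult_left_le)
  moreover have "1 - (\<Sum>i\<in>I. f i) \<le> (\<Prod>i\<in>I. 1 - f i)"
    using insert by simp
  ultimately show ?case
    using insert.hyps by (simp add: algebra_simps)
qed simp

locale exponential_sequence = prob_space N for N :: "'b measure" +
  fixes Y :: "nat \<Rightarrow> 'b \<Rightarrow> real"
  assumes indep: "indep_vars (\<lambda>_. borel) Y {1..}"
    and dist: "\<And>r. r \<ge> 1 \<Longrightarrow> distributed N lborel (Y r) (exponential_density (real r))"
begin

lemma rv: "k \<ge> 1 \<Longrightarrow> Y k \<in> borel_measurable N"
  using distributed_measurable[OF dist] by simp

lemma max_upto_event: "r \<ge> 1 \<Longrightarrow> {\<omega> \<in> space N. \<forall>k\<in>{1..n}. Y k \<omega> \<le> Y r \<omega>} \<in> events"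
  by (intro sets.sets_Collect_finite_All borel_measurable_le rv) auto

text \<open>Continuity from above: the events shrink with \<open>n\<close>, and their intersection
  defines \<open>max_index_prob\<close>.\<close>

lemma max_upto_tendsto:
  assumes r: "r \<ge> 1"
  shows "(\<lambda>n. prob {\<omega> \<in> space N. \<forall>k\<in>{1..n}. Y k \<omega> \<le> Y r \<omega>}) \<longlonglongrightarrow> max_index_prob N Y r"
proof -
  let ?E = "\<lambda>n. {\<omega> \<in> space N. \<forall>k\<in>{1..n}. Y k \<omega> \<le> Y r \<omega>}"
  have "(\<lambda>n. prob (?E n)) \<longlonglongrightarrow> prob (\<Inter>n. ?E n)"
    using max_upto_event[OF r] by (intro finite_Lim_measure_decseq) (auto simp: decseq_def)
  also have "(\<Inter>n. ?E n) = {\<omega> \<in> space N. \<forall>k\<ge>1. Y k \<omega> \<le> Y r \<omega>}"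
    by (auto 4 3)
  finally show ?thesis by (simp add: max_index_prob_def)
qed

lemma prob_gt_ln3: "k \<ge> 1 \<Longrightarrow> prob {\<omega> \<in> space N. ln 3 < Y k \<omega>} = (1/3) ^ k"
proof -
  assume k: "k \<ge> 1"
  have "prob {\<omega> \<in> space N. ln 3 < Y k \<omega>} = exp (- ln 3 * real k)"
    using k by (intro exponential_distributedD_gt[OF dist]) auto
  also have "\<dots> = exp (- ln 3) ^ k"
    unfolding mult.commute[of "- ln 3"] by (rule exp_of_nat_mult)
  also have "exp (- ln 3) = (1/3 :: real)"
    by (simp add: exp_minus)
  finally show ?thesis .
qed

text \<open>The threshold \<open>ln 3\<close> makes the sum of the tail probabilities of all \<open>Y k\<close> at most \<open>1/2\<close>,
  so with positive probability \<open>Y r\<close> is the only variable above it.\<close>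

lemma max_upto_ge:
  assumes r: "r \<in> {1..n}"
  shows "(1/3) ^ r / 2 \<le> prob {\<omega> \<in> space N. \<forall>k\<in>{1..n}. Y k \<omega> \<le> Y r \<omega>}"
proof -
  \<comment> \<open>In this box \<open>Y r\<close> exceeds the threshold and every other
    \<open>Y k\<close> stays at or below it. Independence turns its probability into a
    product.\<close>
  define A where "A = (\<lambda>k. if k = r then {ln 3<..} else {..ln 3 :: real})"
  let ?q = "\<lambda>k::nat. (1/3 :: real) ^ k"
  have le: "prob (Y k -` {..ln 3} \<inter> space N) = 1 - ?q k" if "k \<ge> 1" for k
  proof -
    have "Y k -` {..ln 3} \<inter> space N = space N - {\<omega> \<in> space N. ln 3 < Y k \<omega>}"
      by auto
    then show ?thesis
      using prob_compl[of "{\<omega> \<in> space N. ln 3 < Y k \<omega>}"] prob_gt_ln3[OF that] rv[OF that] by simp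
  qed
  have "(\<Sum>k\<in>{1..n}. ?q k) \<le> 1/2"
  proof -
    have "(\<Sum>k\<in>{1..n}. ?q k) = (1 - ?q n) / 2"
    proof (induction n)
      case (Suc n)
      have "?q (Suc n) = 1/3 * ?q n" by (rule power_Suc)
      moreover have "(\<Sum>k\<in>{1..Suc n}. ?q k) = (\<Sum>k\<in>{1..n}. ?q k) + ?q (Suc n)" by simp
      ultimately show ?case using Suc.IH by argo
    qed simp
    then show ?thesis by simp
  qed
  moreover have "(\<Sum>k\<in>{1..n} - {r}. ?q k) \<le> (\<Sum>k\<in>{1..n}. ?q k)"
    by (intro sum_mono2) auto
  moreover have "1 - (\<Sum>k\<in>{1..n} - {r}. ?q k) \<le> (\<Prod>k\<in>{1..n} - {r}. 1 - ?q k)"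
    by (intro prod_one_minus_ge) (auto intro: power_le_one)
  ultimately have "1/2 \<le> (\<Prod>k\<in>{1..n} - {r}. 1 - ?q k)" by linarith
  then have "?q r * (1/2) \<le> ?q r * (\<Prod>k\<in>{1..n} - {r}. 1 - ?q k)"
    by (intro mult_left_mono) auto
  also have "\<dots> = (\<Prod>k\<in>{1..n}. prob (Y k -` A k \<inter> space N))"
  proof -
    have "Y r -` A r \<inter> space N = {\<omega> \<in> space N. ln 3 < Y r \<omega>}" by (auto simp: A_def)
    then have "prob (Y r -` A r \<inter> space N) = ?q r" using prob_gt_ln3[of r] r by simp
    moreover have "(\<Prod>k\<in>{1..n} - {r}. prob (Y k -` A k \<inter> space N)) = (\<Prod>k\<in>{1..n} - {r}. 1 - ?q k)"
      by (intro prod.cong refl) (auto simp: A_def le)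
    ultimately show ?thesis
      using prod.remove[OF _ r, of "\<lambda>k. prob (Y k -` A k \<inter> space N)"] by simp
  qed
  also have "\<dots> = prob (\<Inter>k\<in>{1..n}. Y k -` A k \<inter> space N)"
    using r by (intro indep_varsD_finite[OF indep_vars_subset[OF indep], symmetric]) (auto simp: A_def)
  also have "\<dots> \<le> prob {\<omega> \<in> space N. \<forall>k\<in>{1..n}. Y k \<omega> \<le> Y r \<omega>}"
  proof (rule finite_measure_mono)
    show "(\<Inter>k\<in>{1..n}. Y k -` A k \<inter> space N) \<subseteq> {\<omega> \<in> space N. \<forall>k\<in>{1..n}. Y k \<omega> \<le> Y r \<omega>}"
    proof (intro subsetI CollectI conjI ballI)
      fix \<omega> assume \<omega>: "\<omega> \<in> (\<Inter>k\<in>{1..n}. Y k -` A k \<inter> space N)"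
      then show "\<omega> \<in> space N" using r by auto
      have in_A: "Y k \<omega> \<in> A k" if "k \<in> {1..n}" for k using \<omega> that by auto
      show "Y k \<omega> \<le> Y r \<omega>" if "k \<in> {1..n}" for k
        using in_A[OF that] in_A[OF r] by (auto simp: A_def split: if_splits)
    qed
  qed (use max_upto_event[of r n] r in auto)
  finally show ?thesis by simp
qed

text \<open>The lower bound of \<open>max_upto_ge\<close> is independent of \<open>n\<close> and
  therefore passes to the limit.\<close>

lemma max_index_prob_pos:
  assumes r: "r \<ge> 1"
  shows "max_index_prob N Y r > 0"
proof -
  have "(1/3) ^ r / 2 \<le> max_index_prob N Y r"
    using max_upto_ge[of r] r by (intro LIMSEQ_le_const[OF max_upto_tendsto[OF r]]) auto
  moreover have "(0::real) < (1/3) ^ r / 2" by simp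
  ultimately show ?thesis by linarith
qed

section \<open>Attainment of the maximum and total mass one\<close>

text \<open>First Borel-Cantelli lemma: the probabilities of exceeding \<open>e\<close> form a
  convergent geometric series with ratio \<open>exp (- e)\<close>.\<close>

lemma AE_eventually_le:
  assumes e: "0 < e"
  shows "AE \<omega> in N. eventually (\<lambda>k. Y k \<omega> \<le> e) sequentially"
proof -
  \<comment> \<open>The shift by \<open>Suc\<close> is needed because the laws are given only from
    index 1 on.\<close>
  let ?A = "\<lambda>k. {\<omega> \<in> space N. e < Y (Suc k) \<omega>}"
  have "prob (?A k) = exp (- e) * exp (- e) ^ k" for k
  proof -
    have "prob (?A k) = exp (- e * real (Suc k))"
      using e by (intro exponential_distributedD_gt[OF dist]) auto
    also have "\<dots> = exp (- e) ^ Suc k"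
      by (simp only: mult.commute[of _ "real (Suc k)"] exp_of_nat_mult)
    finally show ?thesis by simp
  qed
  then have "summable (\<lambda>k. prob (?A k))"
    using e by (simp add: summable_mult summable_geometric)
  then have "AE \<omega> in N. eventually (\<lambda>k. \<omega> \<in> space N - ?A k) sequentially"
    by (intro borel_cantelli_AE1 borel_measurable_less sets.sets_Collect rv) (auto simp: rv emeasure_eq_measure)
  then show ?thesis
  proof eventually_elim
    fix \<omega> assume "eventually (\<lambda>k. \<omega> \<in> space N - ?A k) sequentially"
    then have "eventually (\<lambda>k. Y (Suc k) \<omega> \<le> e) sequentially"
      by (rule eventually_mono) auto
    then show "eventually (\<lambda>k. Y k \<omega> \<le> e) sequentially"
      by (rule eventually_sequentially_Suc[THEN iffD1])
  qed
qed

text \<open>Almost surely \<open>Y 1\<close> is positive and all but finitely many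
  \<open>Y k\<close> fall below it, so a maximum over finitely many indices is a global one.\<close>

lemma AE_max_attained: "AE \<omega> in N. \<exists>r\<ge>1. \<forall>k\<ge>1. Y k \<omega> \<le> Y r \<omega>"
proof -
  have "prob {\<omega> \<in> space N. 0 < Y 1 \<omega>} = exp (- 0 * real 1)"
    by (intro exponential_distributedD_gt[OF dist]) auto
  then have "AE \<omega> in N. \<omega> \<in> {\<omega> \<in> space N. 0 < Y 1 \<omega>}"
    by (intro AE_prob_1) simp
  then have pos: "AE \<omega> in N. 0 < Y 1 \<omega>"
    by eventually_elim simp
  \<comment> \<open>The level to get below, \<open>Y 1 \<omega>\<close>, is random; countably many
    deterministic levels tending to 0 share one null set.\<close>
  have ev: "AE \<omega> in N. \<forall>m. eventually (\<lambda>k. Y k \<omega> \<le> 1 / real (Suc m)) sequentially"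
    unfolding AE_all_countable by (intro allI AE_eventually_le) simp
  from pos ev show ?thesis
  proof eventually_elim
    fix \<omega> assume Y1: "0 < Y 1 \<omega>"
      and ev: "\<forall>m. eventually (\<lambda>k. Y k \<omega> \<le> 1 / real (Suc m)) sequentially"
    obtain m where m: "1 / real (Suc m) < Y 1 \<omega>" using nat_approx_posE[OF Y1] .
    obtain K where K: "\<And>k. k \<ge> K \<Longrightarrow> Y k \<omega> \<le> 1 / real (Suc m)"
      using ev unfolding eventually_sequentially by blast
    \<comment> \<open>With \<open>Suc K\<close> the range contains the index 1 even for
      \<open>K = 0\<close>, so the maximum dominates \<open>Y 1\<close>.\<close>
    let ?V = "(\<lambda>k. Y k \<omega>) ` {1..Suc K}"
    have "Max ?V \<in> ?V" by (intro Max_in) auto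
    then obtain r where r: "Max ?V = Y r \<omega>" "r \<in> {1..Suc K}" by (rule imageE)
    have le: "Y k \<omega> \<le> Y r \<omega>" if "k \<in> {1..Suc K}" for k
      unfolding r(1)[symmetric] using that by (intro Max_ge) auto
    have "Y k \<omega> \<le> Y r \<omega>" if "k \<ge> 1" for k
    proof (cases "k \<le> Suc K")
      case False
      then have "Y k \<omega> < Y 1 \<omega>" using K[of k] m by simp
      also have "\<dots> \<le> Y r \<omega>" by (rule le) simp
      finally show ?thesis by simp
    qed (use le that in auto)
    then show "\<exists>r\<ge>1. \<forall>k\<ge>1. Y k \<omega> \<le> Y r \<omega>" using r(2) by auto
  qed
qed

text \<open>The defining events may overlap on ties. Their strict versions \<open>F r\<close> are
  disjoint, differ from them by null sets, and cover almost every outcome because the maximum is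
  attained. \<open>F r\<close> belongs to \<open>Y (Suc r)\<close>, since series start at 0.\<close>

lemma sums_max_index_prob: "(\<lambda>r. max_index_prob N Y (Suc r)) sums 1"
proof -
  define F where "F = (\<lambda>r. {\<omega> \<in> space N. \<forall>k\<in>{1..} - {Suc r}. Y k \<omega> < Y (Suc r) \<omega>})"
  have F_event: "F r \<in> events" for r
    unfolding F_def by (intro sets.sets_Collect_countable_All' borel_measurable_less rv) auto
  have E_event: "{\<omega> \<in> space N. \<forall>k\<ge>1. Y k \<omega> \<le> Y (Suc r) \<omega>} \<in> events" for r
  proof -
    have "{\<omega> \<in> space N. \<forall>k\<in>{1..}. Y k \<omega> \<le> Y (Suc r) \<omega>} \<in> events"
      by (intro sets.sets_Collect_countable_All' borel_measurable_le rv) auto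
    then show ?thesis by (simp only: Ball_def atLeast_iff)
  qed
  have "AE \<omega> in N. \<forall>i\<in>{1..}. \<forall>j\<in>{1..} - {i}. Y i \<omega> \<noteq> Y j \<omega>"
    by (intro AE_ball_countable' indep_continuous_AE_neq[OF indep _ _ _ dist]) auto
  then have neq: "AE \<omega> in N. \<forall>i\<ge>1. \<forall>j\<ge>1. i \<noteq> j \<longrightarrow> Y i \<omega> \<noteq> Y j \<omega>"
    by eventually_elim auto
  have F_iff: "\<omega> \<in> F r \<longleftrightarrow> (\<forall>k\<ge>1. Y k \<omega> \<le> Y (Suc r) \<omega>)"
    if "\<forall>i\<ge>1. \<forall>j\<ge>1. i \<noteq> j \<longrightarrow> Y i \<omega> \<noteq> Y j \<omega>" "\<omega> \<in> space N" for r \<omega>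
  proof
    assume "\<omega> \<in> F r"
    then have "Y k \<omega> \<le> Y (Suc r) \<omega>" if "k \<ge> 1" for k
      using that by (cases "k = Suc r") (auto simp: F_def less_imp_le)
    then show "\<forall>k\<ge>1. Y k \<omega> \<le> Y (Suc r) \<omega>" by blast
  next
    assume "\<forall>k\<ge>1. Y k \<omega> \<le> Y (Suc r) \<omega>"
    with that show "\<omega> \<in> F r"
      by (auto simp: F_def order.strict_iff_order)
  qed
  have F_prob: "prob (F r) = max_index_prob N Y (Suc r)" for r
    unfolding max_index_prob_def
  proof (rule finite_measure_eq_AE[OF _ F_event E_event])
    show "AE \<omega> in N. \<omega> \<in> F r \<longleftrightarrow> \<omega> \<in> {\<omega> \<in> space N. \<forall>k\<ge>1. Y k \<omega> \<le> Y (Suc r) \<omega>}"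
      using neq AE_space by eventually_elim (simp add: F_iff)
  qed
  have "F i \<inter> F j = {}" if "i \<noteq> j" for i j
  proof (rule ccontr)
    assume "F i \<inter> F j \<noteq> {}"
    then obtain \<omega> where "\<omega> \<in> F i" "\<omega> \<in> F j" by blast
    moreover have "Suc i \<in> {1..} - {Suc j}" "Suc j \<in> {1..} - {Suc i}" using that by auto
    ultimately have "Y (Suc i) \<omega> < Y (Suc j) \<omega>" "Y (Suc j) \<omega> < Y (Suc i) \<omega>"
      unfolding F_def by blast+
    then show False by simp
  qed
  then have "(\<lambda>r. prob (F r)) sums prob (\<Union>r. F r)"
    using F_event by (intro finite_measure_UNION) (auto simp: disjoint_family_on_def)
  moreover have "prob (\<Union>r. F r) = 1"
  proof -
    have "AE \<omega> in N. \<omega> \<in> (\<Union>r. F r)"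
      using neq AE_max_attained AE_space
    proof eventually_elim
      fix \<omega> assume \<omega>: "\<forall>i\<ge>1. \<forall>j\<ge>1. i \<noteq> j \<longrightarrow> Y i \<omega> \<noteq> Y j \<omega>" "\<omega> \<in> space N"
        and "\<exists>r\<ge>1. \<forall>k\<ge>1. Y k \<omega> \<le> Y r \<omega>"
      then obtain r where "r \<ge> 1" "\<forall>k\<ge>1. Y k \<omega> \<le> Y r \<omega>" by blast
      then have "\<omega> \<in> F (r - 1)" using F_iff[OF \<omega>] by simp
      then show "\<omega> \<in> (\<Union>r. F r)" by blast
    qed
    then show ?thesis using F_event by (subst prob_eq_1) auto
  qed
  ultimately show ?thesis by (simp add: F_prob)
qed

end

section \<open>Convergence, positivity and total mass combined\<close>

theorem theorem4p2:
  fixes M :: "nat \<Rightarrow> 'a measure" and X :: "nat \<Rightarrow> nat \<Rightarrow> 'a \<Rightarrow> real"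
    and N :: "'b measure" and Y :: "nat \<Rightarrow> 'b \<Rightarrow> real"
  assumes "\<And>n. n \<ge> 1 \<Longrightarrow> prob_space (M n)"
    and "\<And>n. n \<ge> 1 \<Longrightarrow> prob_space.indep_vars (M n) (\<lambda>_. borel) (X n) {1..n}"
    and "\<And>n i. n \<ge> 1 \<Longrightarrow> i \<in> {1..n} \<Longrightarrow>
           distributed (M n) lborel (X n i) (exponential_density 1)"
    and "prob_space N"
    and "prob_space.indep_vars N (\<lambda>_. borel) Y {1..}"
    and "\<And>r. r \<ge> 1 \<Longrightarrow> distributed N lborel (Y r) (exponential_density (real r))"
  shows "(\<forall>r\<ge>1. (\<lambda>n. max_spacing_prob (M n) (X n) n r) \<longlonglongrightarrow> max_index_prob N Y r) \<and>
         (\<forall>r\<ge>1. max_index_prob N Y r > 0) \<and>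
         (\<lambda>r. max_index_prob N Y (Suc r)) sums 1"
proof -
  interpret N: prob_space N by fact
  interpret exponential_sequence N Y
    by unfold_locales (use assms(5,6) in auto)
  have "(\<lambda>n. max_spacing_prob (M n) (X n) n r) \<longlonglongrightarrow> max_index_prob N Y r" if r: "r \<ge> 1" for r
  \<comment> \<open>The rank probability equals the domination probability once \<open>n\<close> is
    at least \<open>r\<close>, so the sequences agree eventually.\<close>
  proof (rule Lim_transform_eventually[OF max_upto_tendsto[OF r]])
    show "eventually (\<lambda>n. measure N {\<omega> \<in> space N. \<forall>k\<in>{1..n}. Y k \<omega> \<le> Y r \<omega>} =
        max_spacing_prob (M n) (X n) n r) sequentially"
      using eventually_ge_at_top[of r]
    proof eventually_elim
      fix n assume n: "r \<le> n"
      with r have "n \<ge> 1" by simp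
      note Mn = assms(1-3)[OF this]
      have "N.indep_vars (\<lambda>_. borel) Y {1..n}"
        by (rule N.indep_vars_subset[OF indep]) auto
      from max_spacing_prob_eq[OF Mn assms(4) this assms(6), of r] n r
      show "measure N {\<omega> \<in> space N. \<forall>k\<in>{1..n}. Y k \<omega> \<le> Y r \<omega>} = max_spacing_prob (M n) (X n) n r"
        by simp
    qed
  qed
  then show ?thesis
    by (intro conjI allI impI max_index_prob_pos sums_max_index_prob)
qed

end
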